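(* Let $(S,\circ)$ be a twisted right gyrogroup with identity $e$. Then it determines an involutory automorphism $\eta:G_S\to G_S$ such that $$h(x\circ y)=\eta(h)(x)\circ h(y)$$ for all $x\in S$, $y\in S\setminus\{e\}$ and $h\in G_S$. In particular, all the maps $\sigma_y$, $y\in S\setminus\{e\}$, are equal to $\eta$ and hence are automorphisms of $G_S$.
   Context: A right loop $(S,\circ)$ with identity $e$ is a set $S$ with a binary operation $\circ$ and a two-sided identity $e$ such that for all $a,b\in S$ the equation $x\circ a=b$ has a unique solution $x\in S$. The left inverse $x'$ of $x$ is the unique element with $x'\circ x=e$. For $y,z\in S$ the right inner mapping $f(y,z):S\to S$ is the bijection defined by $f(y,z)(x)\circ(y\circ z)=(x\circ y)\circ z$ for all $x\in S$; it fixes $e$. The inner mapping group $G_S$ is the subgroup of $Sym(S\setminus\{e\})\subseteq Sym(S)$ (permutations of $S$ fixing $e$) generated by $\{f(y,z): y,z\in S\}$. Products of maps are composed left to right: $(gf)(x)=f(g(x))$. For $y\in S$ and $h\in G_S$, $\sigma_y(h)\in G_S$ is determined by $\sigma_y(h)(x)\circ h(y)=h(x\circ y)$ for all $x\in S$. An automorphism $\eta$ is involutory if $\eta^2$ is the identity ($\eta$ equal to the identity is allowed). A right loop $(S,\circ)$ is a twisted right gyrogroup if (i) $f(y',y)=I_S$ (the identity map) for all $y\in S$ (consequently $x'$ is the unique two-sided inverse of $x$ for every $x$), and (ii) every right inner mapping $f(y,z)$, $y,z\in S$, is a twisted automorphism, i.e. a bijection $h:S\to S$ with $h(x\circ y)=[h(x')]'\circ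 h(y)$ for all $x,y\in S$ with $y\neq e$. *)

theory Defs
  imports "HOL-Algebra.Bij" "HOL-Algebra.Generated_Groups"
begin

text \<open>The record type \<^typ>\<open>'a monoid\<close> serves only as a container for the set, the operation
  and the identity; associativity is not assumed.\<close>

locale right_loop =
  fixes S (structure)
  assumes m_closed: "\<lbrakk>x \<in> carrier S; y \<in> carrier S\<rbrakk> \<Longrightarrow> x \<otimes> y \<in> carrier S"
    and one_closed: "\<one> \<in> carrier S"
    and l_one: "x \<in> carrier S \<Longrightarrow> \<one> \<otimes> x = x"
    and r_one: "x \<in> carrier S \<Longrightarrow> x \<otimes> \<one> = x"
    and unique_left_quotient:
      "\<lbrakk>a \<in> carrier S; b \<in> carrier S\<rbrakk> \<Longrightarrow> \<exists>!x. x \<in> carrier S \<and> x \<otimes> a = b"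

text \<open>The unique \<open>x\<close> with \<open>x \<otimes> a = b\<close>.\<close>

definition left_quotient :: "('a, 'b) monoid_scheme \<Rightarrow> 'a \<Rightarrow> 'a \<Rightarrow> 'a" where
  "left_quotient S b a = (THE x. x \<in> carrier S \<and> x \<otimes>\<^bsub>S\<^esub> a = b)"

definition left_inv :: "('a, 'b) monoid_scheme \<Rightarrow> 'a \<Rightarrow> 'a" where
  "left_inv S x = left_quotient S \<one>\<^bsub>S\<^esub> x"

text \<open>The right inner mapping \<open>f(y,z)\<close>, determined by
  \<open>f(y,z)(x) \<otimes> (y \<otimes> z) = (x \<otimes> y) \<otimes> z\<close>.  As in \<^const>\<open>Bij\<close>, self-maps of
  the carrier are represented by extensional functions.\<close>

definition inner_map :: "('a, 'b) monoid_scheme \<Rightarrow> 'a \<Rightarrow> 'a \<Rightarrow> 'a \<Rightarrow> 'a" where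
  "inner_map S y z =
    (\<lambda>x\<in>carrier S. left_quotient S ((x \<otimes>\<^bsub>S\<^esub> y) \<otimes>\<^bsub>S\<^esub> z) (y \<otimes>\<^bsub>S\<^esub> z))"

text \<open>Permutations fixing the identity, composed from left to right: \<open>(g \<otimes> f)(x) = f (g x)\<close>,
  which is opposite to the convention of \<^const>\<open>BijGroup\<close>.\<close>

definition stab_group :: "('a, 'b) monoid_scheme \<Rightarrow> ('a \<Rightarrow> 'a) monoid" where
  "stab_group S =
    \<lparr>carrier = {h \<in> Bij (carrier S). h \<one>\<^bsub>S\<^esub> = \<one>\<^bsub>S\<^esub>},
     monoid.mult = (\<lambda>g f. compose (carrier S) f g),
     one = (\<lambda>x\<in>carrier S. x)\<rparr>"

definition inner_mapping_group :: "('a, 'b) monoid_scheme \<Rightarrow> ('a \<Rightarrow> 'a) monoid" where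
  "inner_mapping_group S =
    (stab_group S)\<lparr>carrier :=
      generate (stab_group S) {inner_map S y z |y z. y \<in> carrier S \<and> z \<in> carrier S}\<rparr>"

text \<open>The map \<open>\<sigma>\<^sub>y\<close> on the inner mapping group, determined by
  \<open>\<sigma>\<^sub>y(h)(x) \<otimes> h(y) = h(x \<otimes> y)\<close>.\<close>

definition sigma :: "('a, 'b) monoid_scheme \<Rightarrow> 'a \<Rightarrow> ('a \<Rightarrow> 'a) \<Rightarrow> 'a \<Rightarrow> 'a" where
  "sigma S y =
    (\<lambda>h\<in>carrier (inner_mapping_group S). \<lambda>x\<in>carrier S. left_quotient S (h (x \<otimes>\<^bsub>S\<^esub> y)) (h y))"

definition twisted_automorphism :: "('a, 'b) monoid_scheme \<Rightarrow> ('a \<Rightarrow> 'a) \<Rightarrow> bool" where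
  "twisted_automorphism S h \<longleftrightarrow>
    h \<in> Bij (carrier S) \<and>
    (\<forall>x\<in>carrier S. \<forall>y\<in>carrier S - {\<one>\<^bsub>S\<^esub>}.
      h (x \<otimes>\<^bsub>S\<^esub> y) = left_inv S (h (left_inv S x)) \<otimes>\<^bsub>S\<^esub> h y)"

locale twisted_right_gyrogroup = right_loop +
  assumes inner_map_left_inv:
      "y \<in> carrier S \<Longrightarrow> inner_map S (left_inv S y) y = (\<lambda>x\<in>carrier S. x)"
    and twisted_automorphism_inner_map:
      "\<lbrakk>y \<in> carrier S; z \<in> carrier S\<rbrakk> \<Longrightarrow> twisted_automorphism S (inner_map S y z)"

context right_loop
begin

lemma left_quotient:
  assumes "a \<in> carrier S" "b \<in> carrier S"
  shows "left_quotient S b a \<in> carrier S" "left_quotient S b a \<otimes> a = b"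
  using theI'[OF unique_left_quotient[OF assms]] by (simp_all add: left_quotient_def)

lemma right_cancel:
  "\<lbrakk>u \<otimes> a = v \<otimes> a; u \<in> carrier S; v \<in> carrier S; a \<in> carrier S\<rbrakk> \<Longrightarrow> u = v"
  using unique_left_quotient[of a "v \<otimes> a"] m_closed by blast

lemma inner_map_mult:
  assumes "x \<in> carrier S" "y \<in> carrier S" "z \<in> carrier S"
  shows "inner_map S y z x \<otimes> (y \<otimes> z) = (x \<otimes> y) \<otimes> z"
  using assms by (simp add: inner_map_def left_quotient m_closed)

lemma inner_map_closed:
  assumes "x \<in> carrier S" "y \<in> carrier S" "z \<in> carrier S"
  shows "inner_map S y z x \<in> carrier S"
  using assms by (simp add: inner_map_def left_quotient m_closed)

lemma inner_map_in_stab_group: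
  assumes y: "y \<in> carrier S" and z: "z \<in> carrier S"
  shows "inner_map S y z \<in> carrier (stab_group S)"
proof -
  let ?f = "inner_map S y z"
  have "inj_on ?f (carrier S)"
  proof (rule inj_onI)
    fix u v assume u: "u \<in> carrier S" and v: "v \<in> carrier S" and "?f u = ?f v"
    then have "(u \<otimes> y) \<otimes> z = (v \<otimes> y) \<otimes> z"
      using inner_map_mult y z by metis
    then show "u = v"
      using u v y z right_cancel m_closed by meson
  qed
  moreover have "w \<in> ?f ` carrier S" if w: "w \<in> carrier S" for w
  proof -
    let ?v = "left_quotient S (w \<otimes> (y \<otimes> z)) z"
    let ?u = "left_quotient S ?v y"
    have v: "?v \<in> carrier S" "?v \<otimes> z = w \<otimes> (y \<otimes> z)"
      using w y z by (simp_all add: left_quotient m_closed)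
    have u: "?u \<in> carrier S" "?u \<otimes> y = ?v"
      using v(1) y by (simp_all add: left_quotient)
    have "?f ?u \<otimes> (y \<otimes> z) = w \<otimes> (y \<otimes> z)"
      using inner_map_mult[OF u(1) y z] u(2) v(2) by simp
    then have "?f ?u = w"
      using right_cancel inner_map_closed m_closed u(1) w y z by meson
    then show ?thesis using u(1) by (metis imageI)
  qed
  ultimately have "bij_betw ?f (carrier S) (carrier S)"
    using inner_map_closed y z by (auto simp: bij_betw_def)
  moreover have "?f \<one> = \<one>"
    using right_cancel[of "?f \<one>" "y \<otimes> z" \<one>] inner_map_mult[OF one_closed y z]
      inner_map_closed[OF one_closed y z] y z by (simp add: l_one m_closed one_closed)
  ultimately show ?thesis
    by (simp add: stab_group_def Bij_def inner_map_def)
qed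

lemma group_stab_group: "group (stab_group S)"
proof (rule groupI)
  fix h assume h: "h \<in> carrier (stab_group S)"
  let ?g = "\<lambda>x\<in>carrier S. inv_into (carrier S) h x"
  have b: "bij_betw h (carrier S) (carrier S)" and e: "h \<one> = \<one>" and B: "h \<in> Bij (carrier S)"
    using h by (auto simp: stab_group_def Bij_def)
  have "inv_into (carrier S) h \<one> = \<one>"
    using inv_into_f_f[OF bij_betw_imp_inj_on[OF b] one_closed] e by simp
  moreover have "compose (carrier S) h ?g = (\<lambda>x\<in>carrier S. x)"
    using b by (auto simp: compose_def fun_eq_iff bij_betw_inv_into_right)
  ultimately show "\<exists>g\<in>carrier (stab_group S). g \<otimes>\<^bsub>stab_group S\<^esub> h = \<one>\<^bsub>stab_group S\<^esub>"
    using restrict_inv_into_Bij[OF B] one_closed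
    by (intro bexI[of _ ?g]) (auto simp: stab_group_def)
qed (auto simp: stab_group_def compose_Bij id_Bij one_closed Bij_imp_extensional
      Bij_imp_funcset compose_assoc [symmetric] compose_eq
      intro!: compose_Id[OF Bij_imp_funcset Bij_imp_extensional])

lemma group_inner_mapping_group: "group (inner_mapping_group S)"
proof -
  interpret G: group "stab_group S" by (rule group_stab_group)
  show ?thesis
    unfolding inner_mapping_group_def
    by (rule G.subgroup_imp_group, rule G.generate_is_subgroup)
      (auto intro: inner_map_in_stab_group)
qed

end

end

theory Submission
  imports Defs
begin

text \<open>
  Write \<open>x'\<close> for the left inverse. Condition (i) gives \<open>(z \<otimes> x') \<otimes> x = z\<close>, whence \<open>x \<otimes> x' = \<one>\<close>
  and \<open>x'' = x\<close>. So \<open>x \<mapsto> x'\<close> is an involution of the carrier fixing \<open>\<one>\<close>, and conjugation by it,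
  \<open>\<eta>(h)(x) = (h(x'))'\<close>, is an involutory automorphism of the group of all permutations fixing \<open>\<one>\<close>.
  A permutation \<open>h\<close> is a twisted automorphism exactly when \<open>h(x \<otimes> y) = \<eta>(h)(x) \<otimes> h(y)\<close> for
  \<open>y \<noteq> \<one>\<close>. The twisted automorphisms that fix \<open>\<one>\<close> form a group, because \<open>\<eta>\<close> is an involutory
  homomorphism and their members preserve the condition \<open>y \<noteq> \<one>\<close>; by (ii) this group contains
  the whole inner mapping group.

  The remaining point is that \<open>\<eta>\<close> maps the inner mapping group into itself, and it suffices to
  see this on generators. For any \<open>y \<noteq> \<one>\<close> the displayed identity says that \<open>\<eta>(f(u,v))\<close> is
  \<open>\<sigma>\<^sub>y(f(u,v))\<close>, and in every right loop expanding \<open>((x \<otimes> y) \<otimes> u) \<otimes> v\<close> in two ways expresses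
  \<open>\<sigma>\<^sub>y(f(u,v))\<close> through three inner mappings (lemma \<open>inner_map_cocycle\<close>). A single \<open>y \<noteq> \<one>\<close> is
  enough for this, and if there is none then the only permutation is the identity. Right
  cancellation by \<open>h(y)\<close> then makes \<open>\<eta>(h)\<close> the only possible value of \<open>\<sigma>\<^sub>y(h)\<close>, for every \<open>y \<noteq> \<one>\<close>.
\<close>

section \<open>Inner mappings and the cocycle identity in right loops\<close>

text \<open>Conjugation by the left inverse: the automorphism \<open>\<eta>\<close> before restriction to the inner
  mapping group.\<close>

definition inv_conj :: "('a, 'b) monoid_scheme \<Rightarrow> ('a \<Rightarrow> 'a) \<Rightarrow> 'a \<Rightarrow> 'a" where
  "inv_conj S h = (\<lambda>x\<in>carrier S. left_inv S (h (left_inv S x)))"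

context right_loop
begin

lemma left_inv_closed: "x \<in> carrier S \<Longrightarrow> left_inv S x \<in> carrier S"
  and left_inv_mult: "x \<in> carrier S \<Longrightarrow> left_inv S x \<otimes> x = \<one>"
  by (simp_all add: left_inv_def left_quotient one_closed)

lemma left_quotient_eqI:
  "\<lbrakk>u \<otimes> a = b; u \<in> carrier S; a \<in> carrier S; b \<in> carrier S\<rbrakk> \<Longrightarrow> left_quotient S b a = u"
  using right_cancel[of "left_quotient S b a" a u] left_quotient[of a b] by simp

lemma left_inv_one: "left_inv S \<one> = \<one>"
  unfolding left_inv_def by (rule left_quotient_eqI) (simp_all add: one_closed l_one)

text \<open>Here \<open>s\<close> plays the role of \<open>\<sigma>\<^sub>y(f(u,v))(x)\<close>. After multiplication on the right by
  \<open>(y \<otimes> u) \<otimes> v = f(u,v)(y) \<otimes> (u \<otimes> v)\<close> both sides become \<open>((x \<otimes> y) \<otimes> u) \<otimes> v\<close>.\<close>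

lemma inner_map_cocycle:
  assumes x: "x \<in> carrier S" and y: "y \<in> carrier S" and u: "u \<in> carrier S" and v: "v \<in> carrier S"
    and s: "s \<in> carrier S" "inner_map S u v (x \<otimes> y) = s \<otimes> inner_map S u v y"
  shows "inner_map S (inner_map S u v y) (u \<otimes> v) s
    = inner_map S (y \<otimes> u) v (inner_map S y u x)"
proof (rule right_cancel)
  let ?w = "inner_map S u v y"
  note cl = x y u v s(1) m_closed inner_map_closed
  have w: "?w \<otimes> (u \<otimes> v) = (y \<otimes> u) \<otimes> v"
    by (simp add: inner_map_mult cl)
  have "inner_map S ?w (u \<otimes> v) s \<otimes> (?w \<otimes> (u \<otimes> v)) = (s \<otimes> ?w) \<otimes> (u \<otimes> v)"
    by (rule inner_map_mult) (simp_all add: cl)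
  also have "\<dots> = ((x \<otimes> y) \<otimes> u) \<otimes> v"
    by (simp add: s(2)[symmetric] inner_map_mult cl)
  also have "\<dots> = (inner_map S y u x \<otimes> (y \<otimes> u)) \<otimes> v"
    by (simp add: inner_map_mult cl)
  also have "\<dots> = inner_map S (y \<otimes> u) v (inner_map S y u x) \<otimes> ((y \<otimes> u) \<otimes> v)"
    by (simp add: inner_map_mult[where y = "y \<otimes> u" and z = v] cl)
  finally show "inner_map S ?w (u \<otimes> v) s \<otimes> ((y \<otimes> u) \<otimes> v)
      = inner_map S (y \<otimes> u) v (inner_map S y u x) \<otimes> ((y \<otimes> u) \<otimes> v)"
    by (simp only: w)
qed (simp_all add: x y u v s(1) m_closed inner_map_closed)

lemma stab_groupD:
  assumes "h \<in> carrier (stab_group S)"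
  shows "h \<in> extensional (carrier S)" "bij_betw h (carrier S) (carrier S)" "h \<one> = \<one>"
    "x \<in> carrier S \<Longrightarrow> h x \<in> carrier S"
  using assms by (auto simp: stab_group_def Bij_def bij_betw_def)

lemma stab_group_neq_one:
  "\<lbrakk>h \<in> carrier (stab_group S); y \<in> carrier S - {\<one>}\<rbrakk> \<Longrightarrow> h y \<in> carrier S - {\<one>}"
  using stab_groupD(2-4)[of h] one_closed by (auto simp: bij_betw_def dest: inj_onD[of h _ y \<one>])

lemma stab_group_mult:
  "x \<in> carrier S \<Longrightarrow> (g \<otimes>\<^bsub>stab_group S\<^esub> h) x = h (g x)"
  by (simp add: stab_group_def compose_eq)

lemma stab_group_one: "\<one>\<^bsub>stab_group S\<^esub> = (\<lambda>x\<in>carrier S. x)"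
  by (simp add: stab_group_def)

lemma stab_group_eqI:
  assumes "g \<in> carrier (stab_group S)" "h \<in> carrier (stab_group S)"
    and "\<And>x. x \<in> carrier S \<Longrightarrow> g x = h x"
  shows "g = h"
  using assms stab_groupD(1) by (metis extensionalityI)

lemma stab_group_inv:
  assumes h: "h \<in> carrier (stab_group S)" and x: "x \<in> carrier S"
  shows "h ((inv\<^bsub>stab_group S\<^esub> h) x) = x"
proof -
  interpret G: group "stab_group S" by (rule group_stab_group)
  show ?thesis
    using fun_cong[OF G.l_inv[OF h], of x] x
    by (simp add: stab_group_mult stab_group_one)
qed

lemma carrier_inner_mapping_group:
  "carrier (inner_mapping_group S)
    = generate (stab_group S) {inner_map S y z |y z. y \<in> carrier S \<and> z \<in> carrier S}"
  by (simp add: inner_mapping_group_def)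

lemma mult_inner_mapping_group:
  "g \<otimes>\<^bsub>inner_mapping_group S\<^esub> h = g \<otimes>\<^bsub>stab_group S\<^esub> h"
  by (simp add: inner_mapping_group_def)

lemma subgroup_inner_mapping_group:
  "subgroup (carrier (inner_mapping_group S)) (stab_group S)"
  unfolding carrier_inner_mapping_group
  by (rule group.generate_is_subgroup[OF group_stab_group]) (auto intro: inner_map_in_stab_group)

lemma inner_map_in_inner_mapping_group:
  "\<lbrakk>y \<in> carrier S; z \<in> carrier S\<rbrakk> \<Longrightarrow> inner_map S y z \<in> carrier (inner_mapping_group S)"
  unfolding carrier_inner_mapping_group by (blast intro: generate.incl)

end

section \<open>Conjugation by inversion and twisted automorphisms\<close>

context twisted_right_gyrogroup
begin

text \<open>Evaluating \<open>(z \<otimes> x') \<otimes> x = z\<close>, which is the triviality of \<open>f(x',x)\<close>, at \<open>z = x\<close> and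
  cancelling \<open>x\<close> shows that \<open>x'\<close> is also a right inverse of \<open>x\<close>.\<close>

lemma left_inv_left_inv:
  assumes x: "x \<in> carrier S"
  shows "left_inv S (left_inv S x) = x"
proof -
  let ?x' = "left_inv S x"
  have x': "?x' \<in> carrier S" by (rule left_inv_closed[OF x])
  have "x = (x \<otimes> ?x') \<otimes> x"
    using inner_map_mult[OF x x' x] inner_map_left_inv[OF x] x
    by (simp add: left_inv_mult r_one)
  then have "x \<otimes> ?x' = \<one>"
    using right_cancel[of "x \<otimes> ?x'" x \<one>] x x' by (simp add: l_one m_closed one_closed)
  then show ?thesis
    unfolding left_inv_def[of S ?x'] by (rule left_quotient_eqI) (simp_all add: x x' one_closed)
qed

lemma inv_conj_closed:
  assumes h: "h \<in> carrier (stab_group S)"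
  shows "inv_conj S h \<in> carrier (stab_group S)"
proof -
  have "bij_betw (left_inv S) (carrier S) (carrier S)"
    by (rule bij_betwI[where g = "left_inv S"]) (auto simp: left_inv_closed left_inv_left_inv)
  then have "bij_betw (left_inv S \<circ> (h \<circ> left_inv S)) (carrier S) (carrier S)"
    using stab_groupD(2)[OF h] by (blast intro: bij_betw_trans)
  then have "bij_betw (inv_conj S h) (carrier S) (carrier S)"
    by (subst bij_betw_cong[where g = "left_inv S \<circ> (h \<circ> left_inv S)"])
      (simp_all add: inv_conj_def)
  then show ?thesis
    using stab_groupD(3)[OF h]
    by (simp add: stab_group_def Bij_def inv_conj_def left_inv_one one_closed)
qed

lemma inv_conj_inv_conj:
  assumes h: "h \<in> carrier (stab_group S)"
  shows "inv_conj S (inv_conj S h) = h"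
  using h by (intro stab_group_eqI inv_conj_closed)
    (simp_all add: inv_conj_def left_inv_closed left_inv_left_inv stab_groupD(4))

lemma inv_conj_mult:
  assumes g: "g \<in> carrier (stab_group S)" and h: "h \<in> carrier (stab_group S)"
  shows "inv_conj S (g \<otimes>\<^bsub>stab_group S\<^esub> h) = inv_conj S g \<otimes>\<^bsub>stab_group S\<^esub> inv_conj S h"
proof -
  interpret G: group "stab_group S" by (rule group_stab_group)
  show ?thesis
    using g h by (intro stab_group_eqI inv_conj_closed G.m_closed)
      (simp_all add: inv_conj_def stab_group_mult left_inv_closed left_inv_left_inv stab_groupD(4))
qed

lemma group_hom_inv_conj: "group_hom (stab_group S) (stab_group S) (inv_conj S)"
  by (intro group_hom.intro group_stab_group group_hom_axioms.intro homI
      inv_conj_closed inv_conj_mult)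

lemma twisted_automorphism_iff_inv_conj:
  assumes "h \<in> carrier (stab_group S)"
  shows "twisted_automorphism S h \<longleftrightarrow>
    (\<forall>x\<in>carrier S. \<forall>y\<in>carrier S - {\<one>}. h (x \<otimes> y) = inv_conj S h x \<otimes> h y)"
  using assms by (simp add: twisted_automorphism_def inv_conj_def stab_group_def)

text \<open>A permutation \<open>h\<close> fixing \<open>\<one>\<close> keeps \<open>h(y) \<noteq> \<one>\<close> when \<open>y \<noteq> \<one>\<close>, so a second twisted automorphism
  may be applied to a product with right factor \<open>h(y)\<close>. For the inverse \<open>g\<close> of \<open>h\<close>, applying \<open>h\<close>
  to both sides of the required identity turns each of them into \<open>x \<otimes> y\<close>.\<close>

lemma subgroup_twisted_automorphisms:
  "subgroup {h \<in> carrier (stab_group S). twisted_automorphism S h} (stab_group S)"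
    (is "subgroup ?T _")
proof -
  interpret G: group "stab_group S" by (rule group_stab_group)
  interpret eta: group_hom "stab_group S" "stab_group S" "inv_conj S" by (rule group_hom_inv_conj)
  have T: "h (x \<otimes> y) = inv_conj S h x \<otimes> h y"
    if "h \<in> ?T" "x \<in> carrier S" "y \<in> carrier S - {\<one>}" for h x y
    using that twisted_automorphism_iff_inv_conj[of h] by simp
  show ?thesis
  proof (rule G.subgroupI)
    have "\<one>\<^bsub>stab_group S\<^esub> \<in> ?T"
      using eta.hom_one
      by (simp add: twisted_automorphism_iff_inv_conj) (simp add: stab_group_one m_closed)
    then show "?T \<noteq> {}" by blast
  next
    fix h assume h: "h \<in> ?T"
    then have hc: "h \<in> carrier (stab_group S)" by simp
    let ?g = "inv\<^bsub>stab_group S\<^esub> h"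
    have gc: "?g \<in> carrier (stab_group S)" using hc by simp
    have "?g (x \<otimes> y) = inv_conj S ?g x \<otimes> ?g y"
      if x: "x \<in> carrier S" and y: "y \<in> carrier S - {\<one>}" for x y
    proof -
      have cl: "inv_conj S ?g x \<in> carrier S" "?g y \<in> carrier S - {\<one>}" "?g (x \<otimes> y) \<in> carrier S"
        using x y gc stab_group_neq_one[OF gc y]
        by (simp_all add: stab_groupD(4) inv_conj_closed m_closed)
      have "h (inv_conj S ?g x \<otimes> ?g y) = inv_conj S h (inv_conj S ?g x) \<otimes> h (?g y)"
        by (rule T[OF h cl(1,2)])
      also have "\<dots> = x \<otimes> y"
        using x y hc by (simp add: stab_group_inv eta.hom_inv inv_conj_closed)
      also have "\<dots> = h (?g (x \<otimes> y))"
        using x y hc by (simp add: stab_group_inv m_closed)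
      finally show ?thesis
        using stab_groupD(2)[OF hc] cl by (auto simp: bij_betw_def m_closed dest: inj_onD)
    qed
    then show "?g \<in> ?T"
      using gc by (simp add: twisted_automorphism_iff_inv_conj)
  next
    fix g h assume g: "g \<in> ?T" and h: "h \<in> ?T"
    have gh: "g \<otimes>\<^bsub>stab_group S\<^esub> h \<in> carrier (stab_group S)" using g h by simp
    have "(g \<otimes>\<^bsub>stab_group S\<^esub> h) (x \<otimes> y)
        = inv_conj S (g \<otimes>\<^bsub>stab_group S\<^esub> h) x \<otimes> (g \<otimes>\<^bsub>stab_group S\<^esub> h) y"
      if x: "x \<in> carrier S" and y: "y \<in> carrier S - {\<one>}" for x y
    proof -
      have "inv_conj S g x \<in> carrier S" "g y \<in> carrier S - {\<one>}"
        using g x y stab_group_neq_one[of g y] by (simp_all add: stab_groupD(4) inv_conj_closed)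
      then show ?thesis
        using g h x y T[OF g x y] T[OF h, of "inv_conj S g x" "g y"]
        by (simp add: stab_group_mult m_closed inv_conj_mult)
    qed
    then show "g \<otimes>\<^bsub>stab_group S\<^esub> h \<in> ?T"
      using gh by (simp add: twisted_automorphism_iff_inv_conj)
  qed blast
qed

lemma inner_mapping_group_twisted:
  assumes "h \<in> carrier (inner_mapping_group S)" "x \<in> carrier S" "y \<in> carrier S - {\<one>}"
  shows "h (x \<otimes> y) = inv_conj S h x \<otimes> h y"
proof -
  have "carrier (inner_mapping_group S) \<subseteq> {h \<in> carrier (stab_group S). twisted_automorphism S h}"
    unfolding carrier_inner_mapping_group
    by (rule group.generate_subgroup_incl[OF group_stab_group _ subgroup_twisted_automorphisms])
      (auto intro: inner_map_in_stab_group twisted_automorphism_inner_map)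
  then show ?thesis
    using assms twisted_automorphism_iff_inv_conj by blast
qed

section \<open>Invariance of the inner mapping group and uniqueness\<close>

text \<open>For \<open>y \<noteq> \<one>\<close> the cocycle identity, read in the group with left-to-right composition, is
  \<open>\<eta>(f(u,v)) f(f(u,v)(y), u \<otimes> v) = f(y,u) f(y \<otimes> u, v)\<close>, which can be solved for \<open>\<eta>(f(u,v))\<close>.\<close>

lemma inv_conj_inner_map_closed:
  assumes u: "u \<in> carrier S" and v: "v \<in> carrier S"
  shows "inv_conj S (inner_map S u v) \<in> carrier (inner_mapping_group S)"
proof -
  interpret G: group "stab_group S" by (rule group_stab_group)
  interpret I: subgroup "carrier (inner_mapping_group S)" "stab_group S"
    by (rule subgroup_inner_mapping_group)
  let ?f = "inner_map S u v"
  have f: "?f \<in> carrier (stab_group S)" by (rule inner_map_in_stab_group[OF u v])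
  then have ec: "inv_conj S ?f \<in> carrier (stab_group S)" by (rule inv_conj_closed)
  show ?thesis
  proof (cases "carrier S = {\<one>}")
    case True
    then have "inv_conj S ?f = \<one>\<^bsub>stab_group S\<^esub>"
      using ec by (intro stab_group_eqI[OF ec G.one_closed]) (simp add: stab_groupD(3) stab_group_one)
    then show ?thesis by simp
  next
    case False
    then obtain y where y: "y \<in> carrier S - {\<one>}" using one_closed by blast
    let ?a = "inner_map S y u" and ?b = "inner_map S (y \<otimes> u) v" and ?c = "inner_map S (?f y) (u \<otimes> v)"
    have abc: "?a \<in> carrier (inner_mapping_group S)" "?b \<in> carrier (inner_mapping_group S)"
      "?c \<in> carrier (inner_mapping_group S)"
      using y u v by (simp_all add: inner_map_in_inner_mapping_group inner_map_closed m_closed)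
    have "inv_conj S ?f \<otimes>\<^bsub>stab_group S\<^esub> ?c = ?a \<otimes>\<^bsub>stab_group S\<^esub> ?b"
    proof (rule stab_group_eqI)
      fix x assume x: "x \<in> carrier S"
      have "?c (inv_conj S ?f x) = ?b (?a x)"
        using x y u v ec inner_mapping_group_twisted[OF inner_map_in_inner_mapping_group[OF u v] x y]
        by (intro inner_map_cocycle) (simp_all add: stab_groupD(4))
      then show "(inv_conj S ?f \<otimes>\<^bsub>stab_group S\<^esub> ?c) x = (?a \<otimes>\<^bsub>stab_group S\<^esub> ?b) x"
        using x by (simp add: stab_group_mult)
    qed (use ec abc in simp_all)
    then have "inv_conj S ?f = ?a \<otimes>\<^bsub>stab_group S\<^esub> ?b \<otimes>\<^bsub>stab_group S\<^esub> inv\<^bsub>stab_group S\<^esub> ?c"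
      using ec abc G.inv_solve_right[of "inv_conj S ?f" "?a \<otimes>\<^bsub>stab_group S\<^esub> ?b" ?c] by simp
    then show ?thesis using abc by simp
  qed
qed

lemma inv_conj_inner_mapping_group:
  assumes "h \<in> carrier (inner_mapping_group S)"
  shows "inv_conj S h \<in> carrier (inner_mapping_group S)"
proof -
  interpret eta: group_hom "stab_group S" "stab_group S" "inv_conj S" by (rule group_hom_inv_conj)
  let ?K = "{inner_map S y z |y z. y \<in> carrier S \<and> z \<in> carrier S}"
  have "inv_conj S ` generate (stab_group S) ?K = generate (stab_group S) (inv_conj S ` ?K)"
    by (rule eta.generate_img[symmetric]) (auto intro: inner_map_in_stab_group)
  also have "\<dots> \<subseteq> carrier (inner_mapping_group S)"
    by (rule group.generate_subgroup_incl[OF group_stab_group _ subgroup_inner_mapping_group])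
      (auto intro: inv_conj_inner_map_closed)
  finally show ?thesis
    using assms carrier_inner_mapping_group by blast
qed

lemma restrict_inv_conj_auto:
  "restrict (inv_conj S) (carrier (inner_mapping_group S)) \<in> auto (inner_mapping_group S)"
proof -
  interpret I: subgroup "carrier (inner_mapping_group S)" "stab_group S"
    by (rule subgroup_inner_mapping_group)
  have "bij_betw (inv_conj S) (carrier (inner_mapping_group S)) (carrier (inner_mapping_group S))"
    by (rule bij_betwI[where g = "inv_conj S"])
      (auto simp: inv_conj_inner_mapping_group inv_conj_inv_conj)
  then show ?thesis
    by (auto simp: auto_def hom_def Bij_def inv_conj_inner_mapping_group mult_inner_mapping_group
        inv_conj_mult)
qed

text \<open>If \<open>S\<close> has only one element there is no \<open>y \<noteq> \<one>\<close> to cancel; uniqueness then holds because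
  the only permutation is the identity.\<close>

lemma twisting_map_unique:
  assumes \<theta>: "\<theta> \<in> extensional (carrier (inner_mapping_group S))"
      "\<And>h. h \<in> carrier (inner_mapping_group S) \<Longrightarrow> \<theta> h \<in> carrier (stab_group S)"
    and twist: "\<And>x y h. \<lbrakk>x \<in> carrier S; y \<in> carrier S - {\<one>}; h \<in> carrier (inner_mapping_group S)\<rbrakk>
      \<Longrightarrow> h (x \<otimes> y) = \<theta> h x \<otimes> h y"
  shows "\<theta> = restrict (inv_conj S) (carrier (inner_mapping_group S))"
proof (rule extensionalityI[OF \<theta>(1) restrict_extensional])
  interpret I: subgroup "carrier (inner_mapping_group S)" "stab_group S"
    by (rule subgroup_inner_mapping_group)
  fix h assume h: "h \<in> carrier (inner_mapping_group S)"
  have hc: "h \<in> carrier (stab_group S)" "inv_conj S h \<in> carrier (stab_group S)"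
    using h by (simp_all add: inv_conj_closed)
  have "\<theta> h x = inv_conj S h x" if x: "x \<in> carrier S" for x
  proof (cases "carrier S = {\<one>}")
    case True
    then show ?thesis using x \<theta>(2)[OF h] hc by (simp add: stab_groupD(3))
  next
    case False
    then obtain y where y: "y \<in> carrier S - {\<one>}" using one_closed by blast
    show ?thesis
    proof (rule right_cancel)
      show "\<theta> h x \<otimes> h y = inv_conj S h x \<otimes> h y"
        by (rule trans[OF twist[OF x y h, symmetric] inner_mapping_group_twisted[OF h x y]])
    qed (use x y \<theta>(2)[OF h] hc in \<open>simp_all add: stab_groupD(4)\<close>)
  qed
  then show "\<theta> h = restrict (inv_conj S) (carrier (inner_mapping_group S)) h"
    unfolding restrict_apply'[OF h] by (rule stab_group_eqI[OF \<theta>(2)[OF h] hc(2)])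
qed

lemma sigma_eq_inv_conj:
  assumes y: "y \<in> carrier S - {\<one>}"
  shows "sigma S y = restrict (inv_conj S) (carrier (inner_mapping_group S))"
proof -
  interpret I: subgroup "carrier (inner_mapping_group S)" "stab_group S"
    by (rule subgroup_inner_mapping_group)
  have "left_quotient S (h (x \<otimes> y)) (h y) = inv_conj S h x"
    if h: "h \<in> carrier (inner_mapping_group S)" and x: "x \<in> carrier S" for h x
    using inner_mapping_group_twisted[OF h x y] h x y
    by (intro left_quotient_eqI) (simp_all add: stab_groupD(4) inv_conj_closed m_closed)
  then show ?thesis
    unfolding sigma_def
    by (intro restrict_ext extensionalityI[where A = "carrier S"])
      (simp_all add: inv_conj_def)
qed

end

theorem proposition4p5:
  fixes S :: "('a, 'b) monoid_scheme" (structure)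
  assumes "twisted_right_gyrogroup S"
  shows "\<exists>\<eta>. \<eta> \<in> auto (inner_mapping_group S)
    \<and> (\<forall>h\<in>carrier (inner_mapping_group S). \<eta> (\<eta> h) = h)
    \<and> (\<forall>x\<in>carrier S. \<forall>y\<in>carrier S - {\<one>}. \<forall>h\<in>carrier (inner_mapping_group S).
          h (x \<otimes> y) = \<eta> h x \<otimes> h y)
    \<and> (\<forall>\<eta>'\<in>auto (inner_mapping_group S).
          (\<forall>x\<in>carrier S. \<forall>y\<in>carrier S - {\<one>}. \<forall>h\<in>carrier (inner_mapping_group S).
            h (x \<otimes> y) = \<eta>' h x \<otimes> h y) \<longrightarrow> \<eta>' = \<eta>)
    \<and> (\<forall>y\<in>carrier S - {\<one>}. sigma S y = \<eta> \<and> sigma S y \<in> auto (inner_mapping_group S))"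
proof -
  interpret twisted_right_gyrogroup S by (rule assms)
  interpret I: subgroup "carrier (inner_mapping_group S)" "stab_group S"
    by (rule subgroup_inner_mapping_group)
  let ?G = "inner_mapping_group S"
  let ?\<eta> = "restrict (inv_conj S) (carrier ?G)"
  show ?thesis
  proof (intro exI[of _ ?\<eta>] conjI ballI impI)
    fix h assume "h \<in> carrier ?G"
    then show "?\<eta> (?\<eta> h) = h"
      by (simp add: inv_conj_inner_mapping_group inv_conj_inv_conj)
  next
    fix x y h assume "x \<in> carrier S" "y \<in> carrier S - {\<one>}" "h \<in> carrier ?G"
    then show "h (x \<otimes> y) = ?\<eta> h x \<otimes> h y"
      using inner_mapping_group_twisted by simp
  next
    fix \<theta> assume "\<theta> \<in> auto ?G" "\<forall>x\<in>carrier S. \<forall>y\<in>carrier S - {\<one>}. \<forall>h\<in>carrier ?G.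
      h (x \<otimes> y) = \<theta> h x \<otimes> h y"
    then show "\<theta> = ?\<eta>"
      by (intro twisting_map_unique) (auto simp: auto_def Bij_def hom_def intro: I.mem_carrier)
  next
    fix y assume "y \<in> carrier S - {\<one>}"
    then show "sigma S y = ?\<eta>" "sigma S y \<in> auto ?G"
      by (simp_all add: sigma_eq_inv_conj restrict_inv_conj_auto)
  qed (rule restrict_inv_conj_auto)
qed

end
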